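(* Suppose $G_{1}=(V_{1},E_{1})$ and $G_{2}=(V_{2},E_{2})$ are vertex disjoint finite simple undirected graphs. The independent neighborhood polynomial of their join $G_{1}+G_{2}$ satisfies $$N^{(i)}(G_{1}+G_{2},x)=I(G_{1},x)+I(G_{2},x)-1.$$
   Context: For a finite simple undirected graph $G=(V,E)$ and $v\in V$, the open neighborhood of $v$ is $N(v)=\{u \mid \{u,v\}\in E\}$. The independence polynomial of a graph $G$ of order $n$ is $I(G,x)=\sum_{k=0}^{n} i_k(G)x^k$, where $i_k(G)$ is the number of independent vertex subsets of cardinality $k$ in $G$. The independent neighborhood polynomial of $G$ is $N^{(i)}(G,x)=\sum_{k=0}^{n} n_k^{(i)}(G)x^k$, where $n_k^{(i)}(G)$ is the number of independent vertex subsets $A\subseteq V$ of cardinality $k$ which are subsets of open neighborhoods in $G$, i.e. for which there exists $v\in V$ with $A\subseteq N(v)$. The join $G_1+G_2$ of $G_1=(V_1,E_1)$ and $G_2=(V_2,E_2)$ with disjoint vertex sets is the disjoint union of $G_1$ and $G_2$ (vertex set $V_1\cup V_2$, edge set $E_1\cup E_2$) together with all edges that join vertices in $V_1$ to vertices in $V_2$.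
   Formalization: Both graphs are assumed to have at least one vertex; without this the identity fails, e.g. for G1 with no vertices and G2 a single vertex the left side is 1 and the right side is 1 + x. *)

theory Defs
  imports "HOL-Computational_Algebra.Polynomial"
begin

type_synonym 'a graph = "'a set \<times> 'a set set"

abbreviation verts :: "'a graph \<Rightarrow> 'a set" where
  "verts G \<equiv> fst G"

abbreviation edges :: "'a graph \<Rightarrow> 'a set set" where
  "edges G \<equiv> snd G"

text \<open>The vertex set of a simple graph may be empty here; results that need a vertex
  assume it explicitly.\<close>

definition simple_graph :: "'a graph \<Rightarrow> bool" where
  "simple_graph G \<longleftrightarrow> finite (verts G) \<and> (\<forall>e\<in>edges G. e \<subseteq> verts G \<and> card e = 2)"

definition open_neighborhood :: "'a graph \<Rightarrow> 'a \<Rightarrow> 'a set" where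
  "open_neighborhood G v = {u. {u, v} \<in> edges G}"

definition independent :: "'a graph \<Rightarrow> 'a set \<Rightarrow> bool" where
  "independent G A \<longleftrightarrow> A \<subseteq> verts G \<and> (\<forall>u\<in>A. \<forall>v\<in>A. {u, v} \<notin> edges G)"

definition num_independent :: "'a graph \<Rightarrow> nat \<Rightarrow> nat" where
  "num_independent G k = card {A. independent G A \<and> card A = k}"

text \<open>Integer coefficients, so that subtraction is the genuine one.\<close>

definition independence_poly :: "'a graph \<Rightarrow> int poly" where
  "independence_poly G = (\<Sum>k\<le>card (verts G). monom (int (num_independent G k)) k)"

definition num_independent_neighborhood :: "'a graph \<Rightarrow> nat \<Rightarrow> nat" where
  "num_independent_neighborhood G k =
     card {A. independent G A \<and> card A = k \<and> (\<exists>v\<in>verts G. A \<subseteq> open_neighborhood G v)}"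

definition independent_neighborhood_poly :: "'a graph \<Rightarrow> int poly" where
  "independent_neighborhood_poly G =
     (\<Sum>k\<le>card (verts G). monom (int (num_independent_neighborhood G k)) k)"

definition graph_join :: "'a graph \<Rightarrow> 'a graph \<Rightarrow> 'a graph" where
  "graph_join G1 G2 =
     (verts G1 \<union> verts G2,
      edges G1 \<union> edges G2 \<union> {{u, v} | u v. u \<in> verts G1 \<and> v \<in> verts G2})"

end

theory Submission
  imports Defs
begin

text \<open>A vertex of \<open>G1\<close> and a vertex of \<open>G2\<close> are always adjacent in the join, so an independent set
  of the join lies on one side, and it is independent in the join exactly if it is independent in
  that side. Such a set is automatically contained in an open neighborhood: any vertex of the other
  side, which exists because both graphs are nonempty, is adjacent to all of it. Hence the sets
  counted by the left-hand polynomial are the union of the independent sets of \<open>G1\<close> and those of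
  \<open>G2\<close> (\<open>independent_graph_join_iff\<close>, \<open>independent_graph_join_neighborhood\<close>). As \<open>G1\<close> and \<open>G2\<close>
  share no vertex, these two families have only the empty set in common, which contributes the
  constant \<open>1\<close> that is counted twice.

  To turn this statement about families into one about polynomials, each polynomial is written as
  the sum of \<open>x ^ card A\<close> over the sets \<open>A\<close> that it counts (\<open>sum_monom_card\<close>); inclusion-exclusion
  for sums over a union then gives the identity.\<close>

text \<open>Grouping the members of a finite family by cardinality. With this, identities between
  generating polynomials follow from identities between families, without any comparison of
  coefficients or of the differing upper limits of the defining sums.\<close>

lemma sum_monom_card:
  assumes "finite F" and "\<And>A. A \<in> F \<Longrightarrow> card A \<le> n"
  shows "(\<Sum>k\<le>n. monom (int (card {A \<in> F. card A = k})) k) = (\<Sum>A\<in>F. monom 1 (card A))"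
proof -
  have "(\<Sum>A\<in>F. monom (1::int) (card A)) = (\<Sum>k\<le>n. \<Sum>A\<in>{A \<in> F. card A = k}. monom 1 (card A))"
    using assms by (intro sum.group[symmetric]) auto
  also have "\<dots> = (\<Sum>k\<le>n. monom (int (card {A \<in> F. card A = k})) k)"
    by (intro sum.cong refl) (simp add: of_nat_monom mult_monom)
  finally show ?thesis by simp
qed

lemma finite_independent:
  assumes "finite (verts G)"
  shows "finite {A. independent G A}"
  by (rule finite_subset[of _ "Pow (verts G)"]) (use assms in \<open>auto simp: independent_def\<close>)

lemma card_independent_le:
  assumes "finite (verts G)" and "independent G A"
  shows "card A \<le> card (verts G)"
  using assms by (auto simp: independent_def intro: card_mono)

lemma independence_poly_eq_sum:
  assumes "finite (verts G)"
  shows "independence_poly G = (\<Sum>A | independent G A. monom 1 (card A))"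
  using sum_monom_card[of "{A. independent G A}" "card (verts G)"]
    finite_independent[OF assms] card_independent_le[OF assms]
  by (simp add: independence_poly_def num_independent_def)

lemma independent_neighborhood_poly_eq_sum:
  assumes "finite (verts G)"
  shows "independent_neighborhood_poly G =
    (\<Sum>A | independent G A \<and> (\<exists>v\<in>verts G. A \<subseteq> open_neighborhood G v). monom 1 (card A))"
proof -
  let ?F = "{A. independent G A \<and> (\<exists>v\<in>verts G. A \<subseteq> open_neighborhood G v)}"
  have "finite ?F"
    by (rule finite_subset[OF _ finite_independent[OF assms]]) auto
  then have "(\<Sum>k\<le>card (verts G). monom (int (card {A \<in> ?F. card A = k})) k)
      = (\<Sum>A\<in>?F. monom 1 (card A))"
    by (rule sum_monom_card) (auto intro: card_independent_le[OF assms])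
  moreover have "{A \<in> ?F. card A = k} =
      {A. independent G A \<and> card A = k \<and> (\<exists>v\<in>verts G. A \<subseteq> open_neighborhood G v)}" for k
    by auto
  ultimately show ?thesis
    by (simp add: independent_neighborhood_poly_def num_independent_neighborhood_def)
qed

lemma verts_graph_join: "verts (graph_join G1 G2) = verts G1 \<union> verts G2"
  by (simp add: graph_join_def)

lemma graph_join_commute: "graph_join G1 G2 = graph_join G2 G1"
  by (auto simp: graph_join_def insert_commute)

text \<open>Every edge that the join adds to \<open>G1\<close> contains a vertex of \<open>G2\<close>, so none of them joins two
  vertices of \<open>G1\<close>.\<close>

lemma graph_join_edge_iff:
  assumes "simple_graph G2" and "verts G1 \<inter> verts G2 = {}"
    and "u \<in> verts G1" and "v \<in> verts G1"
  shows "{u, v} \<in> edges (graph_join G1 G2) \<longleftrightarrow> {u, v} \<in> edges G1"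
proof -
  have "u \<notin> verts G2" and "v \<notin> verts G2"
    using assms by auto
  moreover from this have "{u, v} \<notin> edges G2"
    using assms(1) by (auto simp: simple_graph_def)
  ultimately show ?thesis
    by (auto simp: graph_join_def doubleton_eq_iff)
qed

lemma independent_graph_join_left:
  assumes "simple_graph G2" and "verts G1 \<inter> verts G2 = {}" and "A \<subseteq> verts G1"
  shows "independent (graph_join G1 G2) A \<longleftrightarrow> independent G1 A"
proof -
  have "{u, v} \<in> edges (graph_join G1 G2) \<longleftrightarrow> {u, v} \<in> edges G1" if "u \<in> A" "v \<in> A" for u v
    using graph_join_edge_iff[OF assms(1,2)] assms(3) that by blast
  with assms(3) show ?thesis
    by (auto simp: independent_def verts_graph_join)
qed

text \<open>An independent set meeting both sides would contain the two ends of an edge of the join, so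
  it lies on one side, where the join and that side have the same independent sets.\<close>

lemma independent_graph_join_iff:
  assumes "simple_graph G1" and "simple_graph G2" and "verts G1 \<inter> verts G2 = {}"
  shows "independent (graph_join G1 G2) A \<longleftrightarrow> independent G1 A \<or> independent G2 A"
proof -
  have left: "independent (graph_join G1 G2) A \<longleftrightarrow> independent G1 A" if "A \<subseteq> verts G1"
    using independent_graph_join_left assms that by blast
  have right: "independent (graph_join G1 G2) A \<longleftrightarrow> independent G2 A" if "A \<subseteq> verts G2"
    using independent_graph_join_left[of G1 G2 A] assms that
    by (simp add: graph_join_commute[of G1 G2] Int_commute)
  have one_side: "A \<subseteq> verts G1 \<or> A \<subseteq> verts G2" if "independent (graph_join G1 G2) A"
  proof (rule ccontr)
    assume "\<not> ?thesis"
    with that obtain u v where "u \<in> A" "u \<in> verts G1" "v \<in> A" "v \<in> verts G2"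
      by (auto simp: independent_def verts_graph_join)
    moreover from this have "{u, v} \<in> edges (graph_join G1 G2)"
      by (auto simp: graph_join_def)
    ultimately show False
      using that by (auto simp: independent_def)
  qed
  have "A \<subseteq> verts G1" if "independent G1 A"
    using that by (simp add: independent_def)
  moreover have "A \<subseteq> verts G2" if "independent G2 A"
    using that by (simp add: independent_def)
  ultimately show ?thesis
    using left right one_side by blast
qed

lemma verts_subset_open_neighborhood_graph_join:
  assumes "v \<in> verts G2"
  shows "verts G1 \<subseteq> open_neighborhood (graph_join G1 G2) v"
  using assms by (auto simp: open_neighborhood_def graph_join_def)

text \<open>This is where both graphs must have a vertex: the witness for a set on one side is an
  arbitrary vertex of the other side.\<close>

lemma independent_graph_join_neighborhood:
  assumes "verts G1 \<noteq> {}" and "verts G2 \<noteq> {}" and "A \<subseteq> verts G1 \<or> A \<subseteq> verts G2"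
  shows "\<exists>v\<in>verts (graph_join G1 G2). A \<subseteq> open_neighborhood (graph_join G1 G2) v"
proof -
  obtain v1 v2 where v: "v1 \<in> verts G1" "v2 \<in> verts G2"
    using assms by blast
  have "verts G1 \<subseteq> open_neighborhood (graph_join G1 G2) v2"
    using v(2) by (rule verts_subset_open_neighborhood_graph_join)
  moreover have "verts G2 \<subseteq> open_neighborhood (graph_join G1 G2) v1"
    using verts_subset_open_neighborhood_graph_join[OF v(1), of G2]
    by (simp add: graph_join_commute[of G1 G2])
  ultimately show ?thesis
    using v assms(3) unfolding verts_graph_join by blast
qed

theorem theorem2:
  fixes G1 G2 :: "'a graph"
  assumes "simple_graph G1" and "simple_graph G2"
    and "verts G1 \<noteq> {}" and "verts G2 \<noteq> {}"
    and "verts G1 \<inter> verts G2 = {}"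
  shows "independent_neighborhood_poly (graph_join G1 G2)
           = independence_poly G1 + independence_poly G2 - 1"
proof -
  let ?J = "graph_join G1 G2"
  let ?I1 = "{A. independent G1 A}" and ?I2 = "{A. independent G2 A}"
  let ?x = "\<lambda>A :: 'a set. monom (1::int) (card A)"
  have fin: "finite (verts G1)" "finite (verts G2)"
    using assms by (auto simp: simple_graph_def)
  have "A \<subseteq> verts G1 \<or> A \<subseteq> verts G2" if "independent G1 A \<or> independent G2 A" for A
    using that by (auto simp: independent_def)
  then have family:
    "{A. independent ?J A \<and> (\<exists>v\<in>verts ?J. A \<subseteq> open_neighborhood ?J v)} = ?I1 \<union> ?I2"
    using independent_graph_join_iff[OF assms(1,2,5)]
      independent_graph_join_neighborhood[OF assms(3,4)] by blast
  have common: "?I1 \<inter> ?I2 = {{}}"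
    using assms(5) by (auto simp: independent_def)
  have "independent_neighborhood_poly ?J = sum ?x (?I1 \<union> ?I2)"
    using independent_neighborhood_poly_eq_sum[of ?J] fin
    by (simp add: verts_graph_join family[unfolded verts_graph_join])
  also have "\<dots> = sum ?x ?I1 + sum ?x ?I2 - sum ?x (?I1 \<inter> ?I2)"
    by (intro sum_Un finite_independent fin)
  also have "\<dots> = independence_poly G1 + independence_poly G2 - 1"
    unfolding common by (simp add: independence_poly_eq_sum fin)
  finally show ?thesis .
qed

end
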